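(* Let $\Omega\subset\mathbb{R}^2$ be a bounded domain with $C^2$ boundary, and let $a^1,a^2\in C^1(\overline\Omega)$ be such that the diagonal matrix $A=\operatorname{diag}(a^1,a^2)$ is uniformly positive definite over $\overline\Omega$. Write $a^{ij}=a^i$ if $i=j$ and $a^{ij}=0$ if $i\neq j$ ($i,j\in\{1,2\}$). Suppose that at least one of the two functions $a^1_{x_2}$, $a^2_{x_1}$ is either positive everywhere on $\overline\Omega$ or negative everywhere on $\overline\Omega$. Then there exist a function $d\in C^2(\overline\Omega)$ and a constant $\mu_0>0$ such that $$\sum_{i,j=1}^2\bigg\{\sum_{i',j'=1}^2\Big[2a^{ij'}\big(a^{i'j}d_{x_{i'}}\big)_{x_{j'}}-a^{ij}_{x_{j'}}a^{i'j'}d_{x_{i'}}\Big]\bigg\}\xi_i\xi_j\ \ge\ \mu_0\sum_{i,j=1}^2 a^{ij}\xi_i\xi_j$$ for all $(x,\xi_1,\xi_2)\in\overline\Omega\times\mathbb{R}^2$, and $|\nabla d|>0$ in $\overline\Omega$.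
   Context: Subscripts $x_k$ denote partial derivatives with respect to the $k$-th coordinate, e.g. $a^i_{x_k}=\partial a^i/\partial x_k$, $a^{ij}_{x_k}=\partial a^{ij}/\partial x_k$, and $d_{x_k}=\partial d/\partial x_k$. For functions in $C^1(\overline\Omega)$ or $C^2(\overline\Omega)$, derivatives on $\partial\Omega$ are understood as the continuous extensions to $\overline\Omega$. A matrix-valued function $A(x)$ is uniformly positive definite over $\overline\Omega$ if there is a constant $c_0>0$ with $\sum_{i,j}a^{ij}(x)\xi_i\xi_j\ge c_0|\xi|^2$ for all $x\in\overline\Omega$, $\xi\in\mathbb{R}^2$. *)

theory Defs
  imports "HOL-Analysis.Analysis"
begin

text \<open>A function on the closure of an open set \<open>\<Omega>\<close> is represented by a total function on
  the whole space; its values outside \<open>closure \<Omega>\<close> play no role. Classical partial derivatives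
  are taken inside \<open>\<Omega>\<close>; at the remaining points of the closure they are the limits from
  inside \<open>\<Omega>\<close>, that is, the values of the continuous extension whenever there is one.\<close>

definition partial_cl ::
  "(real^'n) set \<Rightarrow> 'n::finite \<Rightarrow> (real^'n \<Rightarrow> real) \<Rightarrow> real^'n \<Rightarrow> real" where
  "partial_cl \<Omega> k f x =
    (if x \<in> \<Omega> then deriv (\<lambda>t. f (x + t *\<^sub>R axis k 1)) 0
     else Lim (at x within \<Omega>) (\<lambda>y. deriv (\<lambda>t. f (y + t *\<^sub>R axis k 1)) 0))"

definition grad_cl :: "(real^'n) set \<Rightarrow> (real^'n \<Rightarrow> real) \<Rightarrow> real^'n::finite \<Rightarrow> real^'n" where
  "grad_cl \<Omega> f x = (\<chi> k. partial_cl \<Omega> k f x)"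

definition C1_closure :: "(real^'n::finite) set \<Rightarrow> (real^'n \<Rightarrow> real) \<Rightarrow> bool" where
  "C1_closure \<Omega> f \<longleftrightarrow> continuous_on (closure \<Omega>) f \<and>
    (\<forall>k. \<exists>g. continuous_on (closure \<Omega>) g \<and>
      (\<forall>x\<in>\<Omega>. ((\<lambda>t. f (x + t *\<^sub>R axis k 1)) has_real_derivative g x) (at 0)))"

definition C2_closure :: "(real^'n::finite) set \<Rightarrow> (real^'n \<Rightarrow> real) \<Rightarrow> bool" where
  "C2_closure \<Omega> f \<longleftrightarrow> C1_closure \<Omega> f \<and> (\<forall>k. C1_closure \<Omega> (partial_cl \<Omega> k f))"

definition C2_real :: "(real \<Rightarrow> real) \<Rightarrow> bool" where
  "C2_real \<phi> \<longleftrightarrow> (\<exists>\<phi>' \<phi>''. (\<forall>t. (\<phi> has_real_derivative \<phi>' t) (at t)) \<and>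
    (\<forall>t. (\<phi>' has_real_derivative \<phi>'' t) (at t)) \<and> continuous_on UNIV \<phi>'')"

text \<open>Near each boundary point, after an orthogonal change of coordinates \<open>T\<close>, the set is the
  part of a ball lying strictly above the graph of a \<open>C\<^sup>2\<close> function.\<close>

definition C2_boundary :: "(real^2) set \<Rightarrow> bool" where
  "C2_boundary \<Omega> \<longleftrightarrow> (\<forall>p\<in>frontier \<Omega>. \<exists>r>0. \<exists>(T :: real^2 \<Rightarrow> real^2) \<phi>.
    orthogonal_transformation T \<and> C2_real \<phi> \<and>
    \<Omega> \<inter> ball p r = {x \<in> ball p r. T x $ 2 > \<phi> (T x $ 1)})"

definition bounded_C2_domain :: "(real^2) set \<Rightarrow> bool" where
  "bounded_C2_domain \<Omega> \<longleftrightarrow>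
    open \<Omega> \<and> connected \<Omega> \<and> \<Omega> \<noteq> {} \<and> bounded \<Omega> \<and> C2_boundary \<Omega>"

definition uniformly_pos_def_on ::
  "(real^'n::finite) set \<Rightarrow> (real^'n \<Rightarrow> real^'n^'n) \<Rightarrow> bool" where
  "uniformly_pos_def_on S A \<longleftrightarrow> (\<exists>c>0. \<forall>x\<in>S. \<forall>\<xi>::real^'n.
    (\<Sum>i\<in>UNIV. \<Sum>j\<in>UNIV. A x $ i $ j * \<xi> $ i * \<xi> $ j) \<ge> c * (norm \<xi>)\<^sup>2)"

definition diag_field :: "('n \<Rightarrow> real^'n \<Rightarrow> real) \<Rightarrow> real^'n::finite \<Rightarrow> real^'n^'n" where
  "diag_field a x = (\<chi> i j. if i = j then a i x else 0)"

end

theory Submission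
  imports Defs
begin

text \<open>If \<open>p = a\<^sup>l\<^bsub>x_k\<^esub>\<close> has a strict sign for some \<open>k \<noteq> l\<close>, take \<open>d = exp (\<lambda> x\<^sub>k)\<close> with \<open>\<lambda>\<close> of the
  opposite sign. With \<open>q = a\<^sup>k\<^bsub>x_l\<^esub>\<close> and \<open>r = a\<^sup>k\<^bsub>x_k\<^esub>\<close>, the form on the left-hand side becomes
  \<open>\<lambda> d ((2 \<lambda> (a\<^sup>k)\<^sup>2 + r a\<^sup>k) \<xi>\<^sub>k\<^sup>2 + 2 q a\<^sup>l \<xi>\<^sub>k \<xi>\<^sub>l - p a\<^sup>k \<xi>\<^sub>l\<^sup>2)\<close>: the coefficient of \<open>\<xi>\<^sub>l\<^sup>2\<close> is positive by the
  sign of \<open>\<lambda> p\<close>, and for large \<open>\<bar>\<lambda>\<bar>\<close> the term \<open>2 \<lambda>\<^sup>2 (a\<^sup>k)\<^sup>2 d \<xi>\<^sub>k\<^sup>2\<close> absorbs the rest.\<close>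

section \<open>Partial derivatives up to the boundary\<close>

text \<open>Boundary values of \<open>partial_cl\<close> are limits from inside, so a continuous
  candidate \<open>g\<close> that is correct on \<Omega> is correct on the whole closure. Explicit
  partial derivatives are obtained this way.\<close>

lemma partial_cl_eqI:
  assumes D: "\<And>y. y \<in> \<Omega> \<Longrightarrow> ((\<lambda>t. f (y + t *\<^sub>R axis k 1)) has_real_derivative g y) (at 0)"
    and cont: "continuous_on (closure \<Omega>) g" and x: "x \<in> closure \<Omega>"
  shows "partial_cl \<Omega> k f x = g x"
proof (cases "x \<in> \<Omega>")
  case True
  then show ?thesis
    using D[OF True] by (simp add: partial_cl_def DERIV_imp_deriv)
next
  case False
  \<comment> \<open>A closure point outside \<Omega> is a limit point, so \<open>Lim\<close> is
    determined by any convergence statement.\<close>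
  then have nt: "at x within \<Omega> \<noteq> bot"
    using x by (simp add: closure_def trivial_limit_within)
  have "(g \<longlongrightarrow> g x) (at x within \<Omega>)"
    using cont x closure_subset by (auto simp: continuous_on_def intro: tendsto_within_subset)
  moreover have "eventually (\<lambda>y. g y = deriv (\<lambda>t. f (y + t *\<^sub>R axis k 1)) 0) (at x within \<Omega>)"
    using D by (auto simp: eventually_at_filter DERIV_imp_deriv[OF D] intro!: always_eventually)
  ultimately have "((\<lambda>y. deriv (\<lambda>t. f (y + t *\<^sub>R axis k 1)) 0) \<longlongrightarrow> g x) (at x within \<Omega>)"
    using tendsto_cong by fastforce
  then show ?thesis
    using False nt by (simp add: partial_cl_def tendsto_Lim)
qed

lemma partial_cl_const:
  assumes "x \<in> closure \<Omega>"
  shows "partial_cl \<Omega> k (\<lambda>_. c) x = 0"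
  by (rule partial_cl_eqI[OF _ _ assms]) auto

lemma C1_closure_has_partial:
  assumes "C1_closure \<Omega> f" and "x \<in> \<Omega>"
  shows "((\<lambda>t. f (x + t *\<^sub>R axis k 1)) has_real_derivative partial_cl \<Omega> k f x) (at 0)"
  using assms by (auto simp: C1_closure_def partial_cl_def DERIV_imp_deriv dest!: spec[of _ k])

text \<open>The existential witness in \<open>C1_closure\<close> is forced to be
  \<open>partial_cl\<close> itself, which can then serve as the canonical derivative.\<close>

lemma C1_closure_continuous_partial:
  assumes "C1_closure \<Omega> f"
  shows "continuous_on (closure \<Omega>) (partial_cl \<Omega> k f)"
proof -
  obtain g where g: "continuous_on (closure \<Omega>) g"
      "\<And>x. x \<in> \<Omega> \<Longrightarrow> ((\<lambda>t. f (x + t *\<^sub>R axis k 1)) has_real_derivative g x) (at 0)"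
    using assms unfolding C1_closure_def by blast
  have "\<And>x. x \<in> closure \<Omega> \<Longrightarrow> partial_cl \<Omega> k f x = g x"
    by (rule partial_cl_eqI) (use g in auto)
  then show ?thesis
    using g(1) continuous_on_cong by metis
qed

lemma eventually_line_in_open:
  fixes x v :: "'a::real_normed_vector"
  assumes "open \<Omega>" and "x \<in> \<Omega>"
  shows "eventually (\<lambda>t. x + t *\<^sub>R v \<in> \<Omega>) (nhds (0::real))"
proof -
  have "((\<lambda>t. x + t *\<^sub>R v) \<longlongrightarrow> x + 0 *\<^sub>R v) (nhds (0::real))"
    by (intro tendsto_intros filterlim_ident)
  then show ?thesis
    using assms by (simp add: topological_tendstoD)
qed

text \<open>Short segments through a point of an open set stay inside it, so arbitrary values
  outside \<Omega> cannot affect the derivative.\<close>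

lemma has_partial_cong_open:
  fixes f g :: "real^'n \<Rightarrow> real"
  assumes "open \<Omega>" and "x \<in> \<Omega>" and "\<And>y. y \<in> \<Omega> \<Longrightarrow> f y = g y"
  shows "((\<lambda>t. f (x + t *\<^sub>R v)) has_real_derivative D) (at 0) \<longleftrightarrow>
         ((\<lambda>t. g (x + t *\<^sub>R v)) has_real_derivative D) (at 0)"
proof (rule DERIV_cong_ev)
  show "eventually (\<lambda>t. f (x + t *\<^sub>R v) = g (x + t *\<^sub>R v)) (nhds 0)"
    using eventually_line_in_open[OF assms(1,2)] by eventually_elim (rule assms(3))
qed auto

lemma C1_closure_cong:
  assumes "open \<Omega>" and eq: "\<And>y. y \<in> closure \<Omega> \<Longrightarrow> f y = g y"
  shows "C1_closure \<Omega> f \<longleftrightarrow> C1_closure \<Omega> g"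
proof -
  have "f y = g y" if "y \<in> \<Omega>" for y
    using that eq closure_subset by blast
  then have "((\<lambda>t. f (x + t *\<^sub>R axis k 1)) has_real_derivative D) (at 0) \<longleftrightarrow>
      ((\<lambda>t. g (x + t *\<^sub>R axis k 1)) has_real_derivative D) (at 0)" if "x \<in> \<Omega>" for x k D
    using that by (intro has_partial_cong_open[OF assms(1)])
  moreover have "continuous_on (closure \<Omega>) f \<longleftrightarrow> continuous_on (closure \<Omega>) g"
    using eq by (rule continuous_on_cong[OF refl])
  ultimately show ?thesis
    by (simp add: C1_closure_def cong: conj_cong)
qed

text \<open>Allows a \<open>partial_cl\<close> nested inside another one to be replaced by its
  closed form, including at boundary points.\<close>

lemma partial_cl_cong:
  assumes "open \<Omega>" and eq: "\<And>y. y \<in> \<Omega> \<Longrightarrow> f y = g y" and "C1_closure \<Omega> g"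
    and "x \<in> closure \<Omega>"
  shows "partial_cl \<Omega> k f x = partial_cl \<Omega> k g x"
proof (rule partial_cl_eqI)
  show "((\<lambda>t. f (y + t *\<^sub>R axis k 1)) has_real_derivative partial_cl \<Omega> k g y) (at 0)"
    if "y \<in> \<Omega>" for y
    using has_partial_cong_open[OF assms(1) that, of f g] eq C1_closure_has_partial[OF assms(3) that]
    by blast
qed (use assms in \<open>auto intro: C1_closure_continuous_partial\<close>)

lemma
  assumes "C1_closure \<Omega> f" and "C1_closure \<Omega> g"
  shows C1_closure_mult: "C1_closure \<Omega> (\<lambda>x. f x * g x)"
    and partial_cl_mult: "\<And>x. x \<in> closure \<Omega> \<Longrightarrow>
      partial_cl \<Omega> k (\<lambda>x. f x * g x) x = partial_cl \<Omega> k f x * g x + partial_cl \<Omega> k g x * f x"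
proof -
  have D: "((\<lambda>t. f (x + t *\<^sub>R axis k 1) * g (x + t *\<^sub>R axis k 1)) has_real_derivative
      partial_cl \<Omega> k f x * g x + partial_cl \<Omega> k g x * f x) (at 0)" if "x \<in> \<Omega>" for x k
    using DERIV_mult[OF C1_closure_has_partial[OF assms(1) that] C1_closure_has_partial[OF assms(2) that], of k k]
    by simp
  have c: "continuous_on (closure \<Omega>) f" "continuous_on (closure \<Omega>) g"
    using assms by (auto simp: C1_closure_def)
  have C: "continuous_on (closure \<Omega>) (\<lambda>x. partial_cl \<Omega> k f x * g x + partial_cl \<Omega> k g x * f x)" for k
    by (intro continuous_intros C1_closure_continuous_partial assms c)
  show "C1_closure \<Omega> (\<lambda>x. f x * g x)"
    unfolding C1_closure_def using D C c by (blast intro: continuous_on_mult)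
  show "partial_cl \<Omega> k (\<lambda>x. f x * g x) x = partial_cl \<Omega> k f x * g x + partial_cl \<Omega> k g x * f x"
    if "x \<in> closure \<Omega>" for x
    by (rule partial_cl_eqI[OF D C that])
qed

section \<open>Exponentials of one coordinate\<close>

text \<open>The factor \<open>c\<close> makes the family closed under partial differentiation
  (\<open>c\<close> becomes \<open>c * s\<close> or 0), so first-order facts also settle second
  derivatives.\<close>

lemma has_partial_exp_coord:
  "((\<lambda>t. c * exp (s * (x + t *\<^sub>R axis j 1) $ k)) has_real_derivative
    (if j = k then c * s else 0) * exp (s * x $ k)) (at 0)"
  by (auto simp: axis_def intro!: derivative_eq_intros)

lemma partial_cl_exp_coord:
  assumes "x \<in> closure \<Omega>"
  shows "partial_cl \<Omega> j (\<lambda>y. c * exp (s * y $ k)) x = (if j = k then c * s else 0) * exp (s * x $ k)"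
  by (rule partial_cl_eqI[OF has_partial_exp_coord _ assms]) (intro continuous_intros)

lemma C1_closure_exp_coord: "C1_closure \<Omega> (\<lambda>y. c * exp (s * y $ k))"
  unfolding C1_closure_def
proof (intro conjI allI exI ballI)
  show "((\<lambda>t. c * exp (s * (x + t *\<^sub>R axis j 1) $ k)) has_real_derivative
    (if j = k then c * s else 0) * exp (s * x $ k)) (at 0)" for x j
    by (rule has_partial_exp_coord)
qed (intro continuous_intros)+

lemma C2_closure_exp_coord:
  assumes "open \<Omega>"
  shows "C2_closure \<Omega> (\<lambda>y. c * exp (s * y $ k))"
proof -
  have "C1_closure \<Omega> (partial_cl \<Omega> j (\<lambda>y. c * exp (s * y $ k)))" for j
    by (subst C1_closure_cong[OF assms partial_cl_exp_coord]) (assumption, rule C1_closure_exp_coord)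
  then show ?thesis
    by (simp add: C2_closure_def C1_closure_exp_coord)
qed

section \<open>Ellipticity, bounds and the quadratic form estimate\<close>

lemma UNIV_2_eq:
  assumes "k \<noteq> (l::2)"
  shows "UNIV = {k, l}"
  using assms by (metis (full_types) UNIV_2 exhaust_2 insert_commute)

text \<open>Testing the form on the unit vector \<open>axis i 1\<close> isolates the
  \<open>i\<close>-th diagonal entry.\<close>

lemma uniformly_pos_def_on_diag_field:
  assumes "uniformly_pos_def_on S (diag_field a)"
  obtains c where "c > 0" and "\<And>x i. x \<in> S \<Longrightarrow> c \<le> a i x"
proof -
  obtain c where c: "c > 0" and le: "\<And>x \<xi>. x \<in> S \<Longrightarrow>
      c * (norm \<xi>)\<^sup>2 \<le> (\<Sum>i\<in>UNIV. \<Sum>j\<in>UNIV. diag_field a x $ i $ j * \<xi> $ i * \<xi> $ j)"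
    using assms unfolding uniformly_pos_def_on_def by blast
  have "c \<le> a i x" if "x \<in> S" for x i
    using le[OF that, of "axis i 1"]
    by (simp add: diag_field_def axis_def[of i] if_distrib[of "(*) _"] if_distrib[of "\<lambda>u. u * _"] cong: if_cong)
      (simp flip: axis_def)
  with c show thesis
    using that by blast
qed

lemma continuous_on_compact_abs_bound:
  fixes f :: "'a::topological_space \<Rightarrow> real"
  assumes "compact S" and "continuous_on S f"
  obtains B where "B \<ge> 0" and "\<And>x. x \<in> S \<Longrightarrow> \<bar>f x\<bar> \<le> B"
proof -
  have "bounded (f ` S)"
    using assms compact_continuous_image compact_imp_bounded by blast
  then show thesis
    using that by (auto simp: bounded_pos intro: less_imp_le)
qed

text \<open>The coefficient of \<open>Y\<close> squared is at least \<open>m * c\<close>: half of it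
  pays for the cross term, half is kept. The three summands in the hypothesis on \<open>L\<close>
  cover \<open>r * u\<close>, the cost of the cross term in \<open>X\<close>, and the
  \<open>m * c / 2\<close> to be kept for \<open>X\<close>. The final factor \<open>1 / C\<close>
  converts back to the weights \<open>u\<close> and \<open>v\<close>.\<close>

lemma quadratic_form_lower_bound:
  fixes p q r u v X Y :: real
  assumes "0 < c" "c \<le> u" "u \<le> C" "0 < v" "v \<le> C" "\<bar>q\<bar> \<le> C" "\<bar>r\<bar> \<le> C" "0 < m" "m \<le> p"
    and L: "2 * c\<^sup>2 * L \<ge> C\<^sup>2 + 2 * C^4 / (m * c) + m * c / 2"
  shows "(2 * u\<^sup>2 * L + r * u) * X\<^sup>2 + 2 * (v * q) * (X * Y) + p * u * Y\<^sup>2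
    \<ge> m * c / (2 * C) * (u * X\<^sup>2 + v * Y\<^sup>2)"
proof -
  have C: "C > 0" and mc: "m * c > 0"
    using assms by auto
  \<comment> \<open>Needed to keep the direction of the inequality when \<open>c\<close> is replaced
    by \<open>u\<close> in the term with \<open>L\<close>.\<close>
  have "L \<ge> 0"
  proof (rule ccontr)
    assume "\<not> L \<ge> 0"
    then have "2 * c\<^sup>2 * L \<le> 0"
      using assms(1) by (simp add: mult_nonneg_nonpos)
    moreover have "C\<^sup>2 + 2 * C^4 / (m * c) + m * c / 2 > 0"
      using C mc by (intro add_pos_pos add_pos_nonneg) auto
    ultimately show False using L by linarith
  qed
  have "c\<^sup>2 \<le> u\<^sup>2"
    using assms by (intro power_mono) auto
  then have 1: "2 * c\<^sup>2 * L \<le> 2 * u\<^sup>2 * L"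
    using \<open>L \<ge> 0\<close> by (intro mult_right_mono) auto
  have "\<bar>r * u\<bar> \<le> C * C"
    unfolding abs_mult using assms by (intro mult_mono) auto
  then have 2: "- C\<^sup>2 \<le> r * u"
    by (simp add: power2_eq_square abs_le_iff)
  have "\<bar>v * q\<bar> \<le> C * C"
    unfolding abs_mult using assms by (intro mult_mono) auto
  then have "(v * q)\<^sup>2 \<le> (C * C)\<^sup>2"
    by (metis abs_ge_zero power2_abs power_mono)
  then have w: "(v * q)\<^sup>2 \<le> C^4"
    by (simp add: power_mult_distrib power4_eq_xxxx power2_eq_square)
  \<comment> \<open>Completing the square: the weights are chosen so that exactly
    \<open>m * c / 2\<close> of the \<open>Y\<close> coefficient is used.\<close>
  have "0 \<le> (m * c * Y + 2 * (v * q) * X)\<^sup>2 / (2 * (m * c))"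
    using mc by simp
  also have "\<dots> = m * c / 2 * Y\<^sup>2 + 2 * (v * q) * (X * Y) + 2 * (v * q)\<^sup>2 / (m * c) * X\<^sup>2"
    using assms(1,8) by (simp add: field_simps power2_eq_square)
  also have "\<dots> \<le> m * c / 2 * Y\<^sup>2 + 2 * (v * q) * (X * Y) + 2 * C^4 / (m * c) * X\<^sup>2"
    using w mc by (intro add_left_mono mult_right_mono divide_right_mono) auto
  finally have 3: "- (m * c / 2) * Y\<^sup>2 - 2 * C^4 / (m * c) * X\<^sup>2 \<le> 2 * (v * q) * (X * Y)"
    by simp
  have 4: "m * c * Y\<^sup>2 \<le> p * u * Y\<^sup>2"
    using assms by (intro mult_right_mono mult_mono) auto
  have 5: "(m * c / 2 + 2 * C^4 / (m * c)) * X\<^sup>2 \<le> (2 * u\<^sup>2 * L + r * u) * X\<^sup>2"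
    using 1 2 L by (intro mult_right_mono) auto
  have "u * X\<^sup>2 + v * Y\<^sup>2 \<le> C * X\<^sup>2 + C * Y\<^sup>2"
    using assms by (intro add_mono mult_right_mono) auto
  then have "m * c / (2 * C) * (u * X\<^sup>2 + v * Y\<^sup>2) \<le> m * c / (2 * C) * (C * X\<^sup>2 + C * Y\<^sup>2)"
    using C mc by (intro mult_left_mono) auto
  also have "\<dots> = m * c / 2 * X\<^sup>2 + m * c / 2 * Y\<^sup>2"
    using C by (simp add: field_simps)
  finally show ?thesis
    using 3 4 5 by (simp add: algebra_simps)
qed

section \<open>The form for the exponential weight\<close>

text \<open>Only \<open>i' = k\<close> survives because \<open>d\<close> depends on one coordinate.
  Diagonality then forces \<open>j = k\<close> and \<open>j' = i\<close> in the first term, and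
  \<open>j' = k\<close> and \<open>i = j\<close> in the second.\<close>

lemma diag_form_exp_coord:
  fixes a :: "2 \<Rightarrow> real^2 \<Rightarrow> real" and s :: real and \<xi> :: "real^2" and k l :: 2
  defines "A \<equiv> \<lambda>i j x. diag_field a x $ i $ j" and "d \<equiv> \<lambda>y. exp (s * y $ k)"
  assumes op: "open \<Omega>" and kl: "k \<noteq> l" and C1: "\<And>i. C1_closure \<Omega> (a i)" and x: "x \<in> closure \<Omega>"
  shows "(\<Sum>i\<in>UNIV. \<Sum>j\<in>UNIV.
        (\<Sum>i'\<in>UNIV. \<Sum>j'\<in>UNIV.
            2 * A i j' x * partial_cl \<Omega> j' (\<lambda>y. A i' j y * partial_cl \<Omega> i' d y) x
          - partial_cl \<Omega> j' (A i j) x * A i' j' x * partial_cl \<Omega> i' d x) * \<xi> $ i * \<xi> $ j)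
    = s * d x * ((2 * (a k x)\<^sup>2 * s + partial_cl \<Omega> k (a k) x * a k x) * (\<xi> $ k)\<^sup>2
      + 2 * (a l x * partial_cl \<Omega> l (a k) x) * (\<xi> $ k * \<xi> $ l)
      - partial_cl \<Omega> k (a l) x * a k x * (\<xi> $ l)\<^sup>2)"
proof -
  have d: "partial_cl \<Omega> j d y = (if j = k then s * exp (s * y $ k) else 0)"
    if "y \<in> closure \<Omega>" for y j
    using partial_cl_exp_coord[OF that, of j 1 s k] by (simp add: d_def)
  have sub: "y \<in> closure \<Omega>" if "y \<in> \<Omega>" for y
    using that closure_subset by blast
  have k: "partial_cl \<Omega> j (\<lambda>y. a i y * partial_cl \<Omega> k d y) x =
      partial_cl \<Omega> j (a i) x * (s * exp (s * x $ k))
      + (if j = k then s * s * exp (s * x $ k) else 0) * a i x" for i j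
    by (subst partial_cl_cong[where g = "\<lambda>y. a i y * (s * exp (s * y $ k))"])
      (use op x sub C1 C1_closure_exp_coord[of \<Omega> s s k] in
        \<open>auto simp: d partial_cl_mult partial_cl_exp_coord intro!: C1_closure_mult\<close>)
  have l: "partial_cl \<Omega> j (\<lambda>y. a i y * partial_cl \<Omega> l d y) x = 0" for i j
    \<comment> \<open>Zero is written as a member of the exponential family so that its regularity
      is already available.\<close>
    by (subst partial_cl_cong[where g = "\<lambda>y. 0 * exp (s * y $ k)"])
      (use op x sub C1 kl C1_closure_exp_coord[of \<Omega> 0 s k] in
        \<open>auto simp: d partial_cl_const\<close>)
  have A: "A i j = (if i = j then a i else (\<lambda>_. 0))" for i j
    by (auto simp: A_def diag_field_def)
  show ?thesis
    unfolding UNIV_2_eq[OF kl]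
    using kl by (simp add: A k l partial_cl_const[OF x] d[OF x])
      (simp add: d_def algebra_simps power2_eq_square)
qed

section \<open>Choice of the weight and the constants\<close>

text \<open>The sign \<tau> and the generic pair \<open>k\<close>, \<open>l\<close> cover all four
  sign alternatives at once; the weight is \<open>exp (s * y $ k)\<close> with
  \<open>s = \<tau> * L\<close> and \<open>L\<close> large.\<close>

lemma exists_weight_of_partial_sign:
  fixes \<Omega> :: "(real^2) set" and a :: "2 \<Rightarrow> real^2 \<Rightarrow> real" and k l :: 2
    and A :: "2 \<Rightarrow> 2 \<Rightarrow> real^2 \<Rightarrow> real" and \<tau> :: real
  defines "A \<equiv> \<lambda>i j x. diag_field a x $ i $ j"
  assumes op: "open \<Omega>" and ne: "\<Omega> \<noteq> {}" and bd: "bounded \<Omega>"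
    and kl: "k \<noteq> l" and C1: "\<And>i. C1_closure \<Omega> (a i)"
    and pd: "uniformly_pos_def_on (closure \<Omega>) (diag_field a)"
    and \<tau>: "\<bar>\<tau>\<bar> = 1" and sgn: "\<And>x. x \<in> closure \<Omega> \<Longrightarrow> \<tau> * partial_cl \<Omega> k (a l) x < 0"
  shows "\<exists>(d :: real^2 \<Rightarrow> real) (\<mu>\<^sub>0 :: real). C2_closure \<Omega> d \<and> \<mu>\<^sub>0 > 0 \<and>
    (\<forall>x\<in>closure \<Omega>. \<forall>\<xi> :: real^2.
      (\<Sum>i\<in>UNIV. \<Sum>j\<in>UNIV.
        (\<Sum>i'\<in>UNIV. \<Sum>j'\<in>UNIV.
            2 * A i j' x * partial_cl \<Omega> j' (\<lambda>y. A i' j y * partial_cl \<Omega> i' d y) x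
          - partial_cl \<Omega> j' (A i j) x * A i' j' x * partial_cl \<Omega> i' d x) * \<xi> $ i * \<xi> $ j)
      \<ge> \<mu>\<^sub>0 * (\<Sum>i\<in>UNIV. \<Sum>j\<in>UNIV. A i j x * \<xi> $ i * \<xi> $ j)) \<and>
    (\<forall>x\<in>closure \<Omega>. norm (grad_cl \<Omega> d x) > 0)"
proof -
  have K: "compact (closure \<Omega>)"
    using bd by simp
  note cp = C1_closure_continuous_partial[OF C1]
  have ca: "continuous_on (closure \<Omega>) (a i)" for i
    using C1[of i] by (simp add: C1_closure_def)
  obtain c where c: "c > 0" "\<And>x i. x \<in> closure \<Omega> \<Longrightarrow> c \<le> a i x"
    using uniformly_pos_def_on_diag_field[OF pd] by blast
  obtain B1 where B1: "B1 \<ge> 0" "\<And>x. x \<in> closure \<Omega> \<Longrightarrow> \<bar>a k x\<bar> \<le> B1"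
    using continuous_on_compact_abs_bound[OF K ca[of k]] by blast
  obtain B2 where B2: "B2 \<ge> 0" "\<And>x. x \<in> closure \<Omega> \<Longrightarrow> \<bar>a l x\<bar> \<le> B2"
    using continuous_on_compact_abs_bound[OF K ca[of l]] by blast
  obtain B3 where B3: "B3 \<ge> 0" "\<And>x. x \<in> closure \<Omega> \<Longrightarrow> \<bar>partial_cl \<Omega> l (a k) x\<bar> \<le> B3"
    using continuous_on_compact_abs_bound[OF K cp[of l k]] by blast
  obtain B4 where B4: "B4 \<ge> 0" "\<And>x. x \<in> closure \<Omega> \<Longrightarrow> \<bar>partial_cl \<Omega> k (a k) x\<bar> \<le> B4"
    using continuous_on_compact_abs_bound[OF K cp[of k k]] by blast
  \<comment> \<open>One common bound for all four coefficients; the 1 makes it strictly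
    positive.\<close>
  define C where "C = B1 + B2 + B3 + B4 + 1"
  have Cpos: "C > 0"
    using B1 B2 B3 B4 by (simp add: C_def)
  \<comment> \<open>Compactness turns the pointwise strict sign into a uniform gap
    \<open>m\<close>.\<close>
  obtain x0 where x0: "x0 \<in> closure \<Omega>"
      "\<And>y. y \<in> closure \<Omega> \<Longrightarrow> \<tau> * partial_cl \<Omega> k (a l) y \<le> \<tau> * partial_cl \<Omega> k (a l) x0"
    using continuous_attains_sup[OF K _ continuous_on_mult_left[OF cp[of k l], of \<tau>]] ne
    by auto
  define m where "m = - \<tau> * partial_cl \<Omega> k (a l) x0"
  have m: "m > 0" "\<And>x. x \<in> closure \<Omega> \<Longrightarrow> m \<le> - \<tau> * partial_cl \<Omega> k (a l) x"
    using sgn[OF x0(1)] x0(2) by (auto simp: m_def)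
  \<comment> \<open>Solves the largeness condition of \<open>quadratic_form_lower_bound\<close> with
    equality.\<close>
  define L where "L = (C\<^sup>2 + 2 * C^4 / (m * c) + m * c / 2) / (2 * c\<^sup>2)"
  have L: "2 * c\<^sup>2 * L \<ge> C\<^sup>2 + 2 * C^4 / (m * c) + m * c / 2"
    using c(1) by (simp add: L_def)
  have Lpos: "L > 0"
    unfolding L_def using Cpos c(1) m(1) by (intro divide_pos_pos add_pos_pos) auto
  define s where "s = \<tau> * L"
  have s0: "s \<noteq> 0"
    using Lpos \<tau> by (auto simp: s_def)
  define d where "d = (\<lambda>y::real^2. exp (s * y $ k))"
  have "continuous_on (closure \<Omega>) d"
    unfolding d_def by (intro continuous_intros)
  then obtain x1 where x1: "x1 \<in> closure \<Omega>" "\<And>y. y \<in> closure \<Omega> \<Longrightarrow> d x1 \<le> d y"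
    using continuous_attains_inf[OF K] ne by fastforce
  \<comment> \<open>The constant of the quadratic estimate, times the least value over the closure
    of the prefactor \<open>L * d x\<close>.\<close>
  define \<mu> where "\<mu> = L * d x1 * (m * c / (2 * C))"
  have "\<mu> > 0"
    using Lpos m(1) c(1) Cpos by (simp add: \<mu>_def d_def)
  moreover have "C2_closure \<Omega> d"
    using C2_closure_exp_coord[OF op, of 1 s k] by (simp add: d_def)
  moreover have "norm (grad_cl \<Omega> d x) > 0" if "x \<in> closure \<Omega>" for x
  proof -
    have "grad_cl \<Omega> d x $ k \<noteq> 0"
      using partial_cl_exp_coord[OF that, of k 1 s k] s0 by (simp add: grad_cl_def d_def)
    then show ?thesis
      by auto
  qed
  moreover have "(\<Sum>i\<in>UNIV. \<Sum>j\<in>UNIV.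
        (\<Sum>i'\<in>UNIV. \<Sum>j'\<in>UNIV.
            2 * A i j' x * partial_cl \<Omega> j' (\<lambda>y. A i' j y * partial_cl \<Omega> i' d y) x
          - partial_cl \<Omega> j' (A i j) x * A i' j' x * partial_cl \<Omega> i' d x) * \<xi> $ i * \<xi> $ j)
      \<ge> \<mu> * (\<Sum>i\<in>UNIV. \<Sum>j\<in>UNIV. A i j x * \<xi> $ i * \<xi> $ j)" (is "?Q \<ge> \<mu> * ?N")
    if x: "x \<in> closure \<Omega>" for x and \<xi> :: "real^2"
  proof -
    \<comment> \<open>Since \<tau> squares to 1, pulling \<tau> out of \<open>s\<close> leaves the
      positive prefactor \<open>L * d x\<close> and multiplies the first-order coefficients by
      \<tau>, so that the last one becomes at least \<open>m\<close>.\<close>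
    define P where "P = (2 * (a k x)\<^sup>2 * L + \<tau> * partial_cl \<Omega> k (a k) x * a k x) * (\<xi> $ k)\<^sup>2
      + 2 * (a l x * (\<tau> * partial_cl \<Omega> l (a k) x)) * (\<xi> $ k * \<xi> $ l)
      + - \<tau> * partial_cl \<Omega> k (a l) x * a k x * (\<xi> $ l)\<^sup>2"
    have \<tau>2: "\<tau> * (\<tau> * z) = z" for z
      using \<tau> by (auto simp: abs_if split: if_splits)
    have Q: "?Q = L * d x * P"
      unfolding A_def d_def diag_form_exp_coord[OF op kl C1 x]
      by (simp add: P_def s_def algebra_simps \<tau>2)
    have N: "?N = a k x * (\<xi> $ k)\<^sup>2 + a l x * (\<xi> $ l)\<^sup>2"
      unfolding UNIV_2_eq[OF kl] using kl by (simp add: A_def diag_field_def power2_eq_square)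
    have pos: "a k x > 0" "a l x > 0"
      using c(1) c(2)[OF x, of k] c(2)[OF x, of l] by auto
    have P: "P \<ge> m * c / (2 * C) * ?N"
      unfolding P_def N
    proof (rule quadratic_form_lower_bound[OF c(1) _ _ _ _ _ _ m(1) _ L])
      show "\<bar>\<tau> * partial_cl \<Omega> l (a k) x\<bar> \<le> C" "\<bar>\<tau> * partial_cl \<Omega> k (a k) x\<bar> \<le> C"
        using B1(1) B2(1) B3(1) B4(1) B3(2)[OF x] B4(2)[OF x] by (simp_all add: abs_mult \<tau> C_def)
      show "a k x \<le> C" "a l x \<le> C"
        using B1(1) B2(1) B3(1) B4(1) B1(2)[OF x] B2(2)[OF x] by (simp_all add: C_def)
    qed (use c(2) m(2) x pos in auto)
    \<comment> \<open>Nonnegativity allows \<open>d x1\<close> to be enlarged to \<open>d x\<close>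
      in the product below.\<close>
    have N0: "m * c / (2 * C) * ?N \<ge> 0"
      unfolding N using pos Cpos m(1) c(1) by simp
    have "\<mu> * ?N = L * d x1 * (m * c / (2 * C) * ?N)"
      by (simp add: \<mu>_def)
    also have "\<dots> \<le> L * d x * P"
      using x1(2)[OF x] Lpos N0 P by (intro mult_mono) (auto simp: d_def)
    finally show ?thesis
      using Q by simp
  qed
  ultimately show ?thesis
    by blast
qed

theorem corollary1p2:
  fixes \<Omega> :: "(real^2) set" and a :: "2 \<Rightarrow> real^2 \<Rightarrow> real"
    and A :: "2 \<Rightarrow> 2 \<Rightarrow> real^2 \<Rightarrow> real"
  defines "A \<equiv> \<lambda>i j x. diag_field a x $ i $ j"
  assumes "bounded_C2_domain \<Omega>"
    and "C1_closure \<Omega> (a 1)" and "C1_closure \<Omega> (a 2)"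
    and "uniformly_pos_def_on (closure \<Omega>) (diag_field a)"
    and "(\<forall>x\<in>closure \<Omega>. partial_cl \<Omega> 2 (a 1) x > 0) \<or>
         (\<forall>x\<in>closure \<Omega>. partial_cl \<Omega> 2 (a 1) x < 0) \<or>
         (\<forall>x\<in>closure \<Omega>. partial_cl \<Omega> 1 (a 2) x > 0) \<or>
         (\<forall>x\<in>closure \<Omega>. partial_cl \<Omega> 1 (a 2) x < 0)"
  shows "\<exists>(d :: real^2 \<Rightarrow> real) (\<mu>\<^sub>0 :: real). C2_closure \<Omega> d \<and> \<mu>\<^sub>0 > 0 \<and>
    (\<forall>x\<in>closure \<Omega>. \<forall>\<xi> :: real^2.
      (\<Sum>i\<in>UNIV. \<Sum>j\<in>UNIV.
        (\<Sum>i'\<in>UNIV. \<Sum>j'\<in>UNIV.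
            2 * A i j' x * partial_cl \<Omega> j' (\<lambda>y. A i' j y * partial_cl \<Omega> i' d y) x
          - partial_cl \<Omega> j' (A i j) x * A i' j' x * partial_cl \<Omega> i' d x) * \<xi> $ i * \<xi> $ j)
      \<ge> \<mu>\<^sub>0 * (\<Sum>i\<in>UNIV. \<Sum>j\<in>UNIV. A i j x * \<xi> $ i * \<xi> $ j)) \<and>
    (\<forall>x\<in>closure \<Omega>. norm (grad_cl \<Omega> d x) > 0)"
proof -
  have \<Omega>: "open \<Omega>" "\<Omega> \<noteq> {}" "bounded \<Omega>"
    using assms(2) by (auto simp: bounded_C2_domain_def)
  have C1: "C1_closure \<Omega> (a i)" for i
    using assms(3,4) exhaust_2[of i] by auto
  note weight = exists_weight_of_partial_sign[OF \<Omega> _ C1 assms(5)]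
  have ne: "(1::2) \<noteq> 2" "(2::2) \<noteq> 1"
    by auto
  show ?thesis
    using assms(6) unfolding A_def
    \<comment> \<open>The cases on \<open>a 1\<close> use \<open>k = 2\<close>,
      \<open>l = 1\<close>, those on \<open>a 2\<close> the reverse; \<tau> is -1 for a positive
      derivative and 1 for a negative one.\<close>
    by (elim disjE)
      (rule weight[OF ne(2), of "-1"] weight[OF ne(2), of 1]
        weight[OF ne(1), of "-1"] weight[OF ne(1), of 1]; simp)+
qed

end
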